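(* For every complex number $s=\sigma+it$ with real part $\sigma>1$, $$\mathfrak{m}(s):=\sum_{n=1}^\infty \frac{\mu_{\infty}(n)}{n^s}=\prod_{j=0}^\infty \zeta(2^j s)^{-1}.$$
   Context: $\zeta$ denotes the Riemann zeta-function. The modified M\"obius function $\mu_\infty:\mathbb{N}\to\{-1,1\}$ is the multiplicative arithmetical function with $\mu_\infty(1)=1$ and, for every prime $p$ and every integer $\nu\ge 1$, $$\mu_\infty(p^\nu)=(-1)^{|B(\nu)|},$$ where $B(\nu)$ is the finite set of non-negative integers with $\nu=\sum_{j\in B(\nu)}2^j$ (so $|B(\nu)|$ is the number of nonzero digits in the binary representation of $\nu$). *)

theory Defs
  imports
    "HOL-Analysis.Infinite_Products"
    "HOL-Analysis.Complex_Transcendental"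
    "HOL-Computational_Algebra.Primes"
    "HOL-Library.Nat_Bijection"
begin

(* Only the half-plane Re s > 1 of the Riemann zeta-function is modelled: there it is defined by
   its absolutely convergent Dirichlet series.  No analytic continuation is built in, so
   the values of this function at points of real part at most 1 are meaningless. *)
definition zeta :: "complex \<Rightarrow> complex" where
  "zeta s = (\<Sum>n. inverse (of_nat (Suc n) powr s))"

definition binary_exponents :: "nat \<Rightarrow> nat set" where
  "binary_exponents \<nu> = (THE B. finite B \<and> \<nu> = (\<Sum>j\<in>B. 2 ^ j))"

lemma binary_exponents_eq_set_decode: "binary_exponents \<nu> = set_decode \<nu>"
  unfolding binary_exponents_def
proof (rule the_equality)
  show "finite (set_decode \<nu>) \<and> \<nu> = (\<Sum>j\<in>set_decode \<nu>. 2 ^ j)"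
    using set_decode_inverse[of \<nu>] by (simp add: set_encode_def)
next
  fix B :: "nat set"
  assume "finite B \<and> \<nu> = (\<Sum>j\<in>B. 2 ^ j)"
  then have "finite B" "\<nu> = set_encode B"
    by (simp_all add: set_encode_def)
  then show "B = set_decode \<nu>"
    by simp
qed

(* The value at 0 is an irrelevant 1.  Theorem mu_inf_unique below shows that on positive
   arguments this is the only multiplicative function with the given values at prime powers. *)
definition mu_inf :: "nat \<Rightarrow> int" where
  "mu_inf n = (\<Prod>p\<in>prime_factors n. (-1) ^ card (binary_exponents (multiplicity p n)))"

lemma mu_inf_1: "mu_inf 1 = 1"
  by (simp add: mu_inf_def)

lemma mu_inf_values: "mu_inf n \<in> {-1, 1}"
proof -
  have "\<bar>mu_inf n\<bar> = 1"
    by (simp add: mu_inf_def abs_prod power_abs)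
  then show ?thesis
    by auto
qed

lemma mu_inf_prime_power:
  assumes "prime p" "\<nu> \<ge> 1"
  shows "mu_inf (p ^ \<nu>) = (-1) ^ card (binary_exponents \<nu>)"
  using assms by (simp add: mu_inf_def prime_factorization_prime_power)

lemma mu_inf_mult:
  assumes "m > 0" "n > 0" "coprime m n"
  shows "mu_inf (m * n) = mu_inf m * mu_inf n"
proof -
  have disj: "prime_factors m \<inter> prime_factors n = {}"
    using assms(3) by (auto simp: in_prime_factors_iff dest: coprime_common_divisor_nat)
  have pf: "prime_factors (m * n) = prime_factors m \<union> prime_factors n"
    using assms by (simp add: prime_factors_product)
  have mult: "multiplicity p (m * n) = multiplicity p m + multiplicity p n" if "prime p" for p
    using that assms by (intro prime_elem_multiplicity_mult_distrib) auto
  have m: "multiplicity p (m * n) = multiplicity p m" if "p \<in> prime_factors m" for p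
  proof -
    have "\<not> p dvd n" using that disj assms(2) by (auto simp: in_prime_factors_iff)
    then show ?thesis using mult[of p] that by (simp add: not_dvd_imp_multiplicity_0 in_prime_factors_imp_prime)
  qed
  have n: "multiplicity p (m * n) = multiplicity p n" if "p \<in> prime_factors n" for p
  proof -
    have "\<not> p dvd m" using that disj assms(1) by (auto simp: in_prime_factors_iff)
    then show ?thesis using mult[of p] that by (simp add: not_dvd_imp_multiplicity_0 in_prime_factors_imp_prime)
  qed
  show ?thesis
    unfolding mu_inf_def pf using disj
    by (subst prod.union_disjoint) (auto simp: m n)
qed

theorem mu_inf_unique:
  fixes f :: "nat \<Rightarrow> int"
  assumes one: "f 1 = 1"
    and mult: "\<And>m n. m > 0 \<Longrightarrow> n > 0 \<Longrightarrow> coprime m n \<Longrightarrow> f (m * n) = f m * f n"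
    and pow: "\<And>p \<nu>. prime p \<Longrightarrow> \<nu> \<ge> 1 \<Longrightarrow> f (p ^ \<nu>) = (-1) ^ card (binary_exponents \<nu>)"
    and "n > 0"
  shows "f n = mu_inf n"
  using \<open>n > 0\<close>
proof (induction n rule: less_induct)
  case (less n)
  show ?case
  proof (cases "n = 1")
    case True
    then show ?thesis using one mu_inf_1 by simp
  next
    case False
    then obtain p where p: "prime p" "p dvd n"
      using prime_factor_nat by blast
    define k where "k = multiplicity p n"
    have "k \<ge> 1"
      using p less.prems unfolding k_def
      by (metis One_nat_def Suc_leI multiplicity_gt_zero_iff not_prime_unit neq0_conv)
    obtain r where r: "n = p ^ k * r" "\<not> p dvd r"
      using multiplicity_decompose'[of n p] p less.prems unfolding k_def
      by (metis neq0_conv not_prime_unit)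
    have "r > 0" using r less.prems by (cases r) auto
    have "p ^ k > 1" using p \<open>k \<ge> 1\<close> by (metis One_nat_def Suc_le_lessD one_less_power prime_gt_1_nat)
    then have "r < n" using r(1) \<open>r > 0\<close> by simp
    have cop: "coprime (p ^ k) r"
      using p r(2) by (simp add: prime_imp_coprime)
    have "p ^ k > 0" using \<open>p ^ k > 1\<close> by linarith
    then show ?thesis
      using mult[OF _ \<open>r > 0\<close> cop] mu_inf_mult[OF _ \<open>r > 0\<close> cop]
        pow[OF p(1) \<open>k \<ge> 1\<close>] mu_inf_prime_power[OF p(1) \<open>k \<ge> 1\<close>] less.IH[OF \<open>r < n\<close> \<open>r > 0\<close>] r(1)
      by simp
  qed
qed

definition mu_inf_series :: "complex \<Rightarrow> complex" where
  "mu_inf_series s = (\<Sum>n. of_int (mu_inf (Suc n)) / of_nat (Suc n) powr s)"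

end

(* The partial sums of (-1)^|B(i)| over i <= k vanish for odd k and equal (-1)^|B(k/2)| for even k.
   By multiplicativity the divisor sum of mu_inf is therefore mu_inf (m) at n = m^2 and 0 at
   non-squares, that is, zeta(s) m(s) = m(2s).  Iterating, the product of zeta(2^j s) over j < N,
   multiplied by m(s), equals m(2^N s), which tends to 1.  This limit also shows that m(s) and all
   zeta(2^j s) are nonzero, so no separate non-vanishing result for zeta is needed. *)
theory Submission
  imports Defs "HOL-Analysis.Infinite_Sum" "HOL-Analysis.Summation_Tests" "HOL-Computational_Algebra.Nth_Powers"
begin

section \<open>Divisor sums of products over primes\<close>

lemma sum_divisors_prod_multiplicity:
  fixes f :: "nat \<Rightarrow> nat \<Rightarrow> 'a::comm_semiring_1"
  assumes "n > 0"
  shows "(\<Sum>d | d dvd n. \<Prod>p\<in>prime_factors n. f p (multiplicity p d))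
    = (\<Prod>p\<in>prime_factors n. \<Sum>k\<le>multiplicity p n. f p k)"
proof -
  let ?P = "prime_factors n" and ?E = "PiE (prime_factors n) (\<lambda>p. {..multiplicity p n})"
  let ?num = "\<lambda>g. \<Prod>p\<in>?P. p ^ g p"
  have num_pos: "?num g > 0" for g :: "nat \<Rightarrow> nat"
    by (auto intro!: prod_pos dest!: in_prime_factors_imp_prime prime_gt_0_nat)
  have mult: "multiplicity p (?num g) = (if p \<in> ?P then g p else 0)" if "prime p" for p and g :: "nat \<Rightarrow> nat"
    using that by (intro multiplicity_prod_prime_powers) auto
  \<comment> \<open>Divisors of \<open>n\<close> correspond to exponent vectors bounded by the
    multiplicities of \<open>n\<close>: \<open>?num\<close> rebuilds the divisor, and
    \<open>restrict\<close> normalises the vector off \<open>?P\<close>, as \<open>PiE\<close>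
    demands. Expanding the product of sums then runs over exactly these vectors.\<close>
  have "(\<Sum>d | d dvd n. \<Prod>p\<in>?P. f p (multiplicity p d)) = (\<Sum>g\<in>?E. \<Prod>p\<in>?P. f p (g p))"
  proof (rule sum.reindex_bij_witness[where i = ?num and j = "\<lambda>d. restrict (\<lambda>p. multiplicity p d) ?P"])
    fix d assume "d \<in> {d. d dvd n}"
    then have d: "d dvd n" "d > 0"
      using assms by (auto intro: dvd_pos_nat)
    show "restrict (\<lambda>p. multiplicity p d) ?P \<in> ?E"
      using d assms by (auto intro: dvd_imp_multiplicity_le)
    show "?num (restrict (\<lambda>p. multiplicity p d) ?P) = d"
    proof (rule multiplicity_eq_nat)
      fix p :: nat assume "prime p"
      moreover have "multiplicity p d = 0" if "p \<notin> ?P"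
        using that \<open>prime p\<close> d assms
        by (intro not_dvd_imp_multiplicity_0) (auto simp: in_prime_factors_iff intro: dvd_trans)
      ultimately show "multiplicity p (?num (restrict (\<lambda>p. multiplicity p d) ?P)) = multiplicity p d"
        by (subst mult) auto
    qed (use num_pos d in auto)
    show "(\<Prod>p\<in>?P. f p (restrict (\<lambda>p. multiplicity p d) ?P p)) = (\<Prod>p\<in>?P. f p (multiplicity p d))"
      by simp
  next
    fix g assume g: "g \<in> ?E"
    show "restrict (\<lambda>p. multiplicity p (?num g)) ?P = g"
    proof (rule extensionalityI[of _ ?P])
      show "g \<in> extensional ?P"
        using g by (simp add: PiE_def)
    qed (auto simp: mult in_prime_factors_imp_prime)
    show "?num g \<in> {d. d dvd n}"
    proof (intro CollectI multiplicity_le_imp_dvd)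
      fix p :: nat assume "prime p"
      then show "multiplicity p (?num g) \<le> multiplicity p n"
        using g by (auto simp: mult PiE_iff)
    qed (use num_pos[of g] in linarith)
  qed
  then show ?thesis
    by (subst prod_sum_PiE) auto
qed

section \<open>Binary digit counts and the divisor sum of \<open>mu_inf\<close>\<close>

lemma card_binary_exponents_double: "card (binary_exponents (2 * k)) = card (binary_exponents k)"
proof -
  have "binary_exponents (2 * k) = Suc ` binary_exponents k"
  proof (rule set_eqI)
    fix j show "j \<in> binary_exponents (2 * k) \<longleftrightarrow> j \<in> Suc ` binary_exponents k"
      by (cases j) (auto simp: binary_exponents_eq_set_decode)
  qed
  then show ?thesis
    by (simp add: card_image)
qed

lemma card_binary_exponents_Suc_double:
  "card (binary_exponents (Suc (2 * k))) = Suc (card (binary_exponents k))"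
proof -
  have "binary_exponents (Suc (2 * k)) = insert 0 (Suc ` binary_exponents k)"
  proof (rule set_eqI)
    fix j show "j \<in> binary_exponents (Suc (2 * k)) \<longleftrightarrow> j \<in> insert 0 (Suc ` binary_exponents k)"
      by (cases j) (auto simp: binary_exponents_eq_set_decode)
  qed
  moreover have "finite (binary_exponents k)"
    by (simp add: binary_exponents_eq_set_decode)
  ultimately show ?thesis
    by (simp add: card_image)
qed

text \<open>The numbers 2j and 2j + 1 differ only in the last binary digit, so their signs cancel in
  pairs. For even \<open>k\<close> the last term is left without a partner.\<close>

lemma sum_binary_signs:
  "(\<Sum>i\<le>k. (-1) ^ card (binary_exponents i)) =
    (if even k then (-1) ^ card (binary_exponents k) else (0 :: int))"
proof (induction k)
  case 0
  then show ?case by simp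
next
  case (Suc k)
  then show ?case
    by (auto elim!: evenE
        simp: card_binary_exponents_double card_binary_exponents_Suc_double)
qed

lemma sum_divisors_mu_inf:
  assumes "n > 0"
  shows "(\<Sum>d | d dvd n. mu_inf d) = (\<Prod>p\<in>prime_factors n.
    if even (multiplicity p n) then (-1) ^ card (binary_exponents (multiplicity p n)) else 0)"
proof -
  \<comment> \<open>The product is extended to an index set independent of \<open>d\<close>. A prime
    of \<open>n\<close> not dividing \<open>d\<close> has exponent 0 there, whose empty digit set
    contributes the factor 1.\<close>
  have "mu_inf d = (\<Prod>p\<in>prime_factors n. (-1) ^ card (binary_exponents (multiplicity p d)))"
    if "d dvd n" for d
    unfolding mu_inf_def
  proof (rule prod.mono_neutral_left)
    show "prime_factors d \<subseteq> prime_factors n"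
      using that assms by (simp add: dvd_prime_factors)
    show "\<forall>p\<in>prime_factors n - prime_factors d. (-1) ^ card (binary_exponents (multiplicity p d)) = (1::int)"
      using that assms
      by (auto simp: in_prime_factors_iff not_dvd_imp_multiplicity_0 binary_exponents_eq_set_decode)
  qed simp
  then have "(\<Sum>d | d dvd n. mu_inf d) =
    (\<Sum>d | d dvd n. \<Prod>p\<in>prime_factors n. (-1) ^ card (binary_exponents (multiplicity p d)))"
    by (intro sum.cong) auto
  also have "\<dots> = (\<Prod>p\<in>prime_factors n. \<Sum>k\<le>multiplicity p n. (-1) ^ card (binary_exponents k))"
    by (rule sum_divisors_prod_multiplicity) (use assms in simp)
  finally show ?thesis
    by (simp only: sum_binary_signs)
qed

text \<open>All exponents of a square are even, and halving them leaves the digit count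
  unchanged.\<close>

lemma sum_divisors_mu_inf_square:
  assumes "m > 0"
  shows "(\<Sum>d | d dvd m\<^sup>2. mu_inf d) = mu_inf m"
proof -
  have "multiplicity p (m\<^sup>2) = 2 * multiplicity p m" if "p \<in> prime_factors m" for p
    using that assms by (intro prime_elem_multiplicity_power_distrib) auto
  moreover have "prime_factors (m\<^sup>2) = prime_factors m"
    using assms by (auto simp: in_prime_factors_iff prime_dvd_power_iff)
  ultimately show ?thesis
    using assms sum_divisors_mu_inf[of "m\<^sup>2"]
    by (simp add: mu_inf_def[of m] card_binary_exponents_double)
qed

text \<open>Some prime has odd multiplicity in a non-square, and its factor in the product formula
  is 0.\<close>

lemma sum_divisors_mu_inf_nonsquare:
  assumes "n > 0" "\<nexists>m. n = m\<^sup>2"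
  shows "(\<Sum>d | d dvd n. mu_inf d) = 0"
proof -
  have "\<not> is_nth_power 2 n"
    using assms(2) by (auto elim!: is_nth_powerE)
  then obtain p where p: "prime p" "odd (multiplicity p n)"
    by (auto simp: is_nth_power_conv_multiplicity_nat)
  then have "p \<in> prime_factors n"
    using assms(1) by (cases "p dvd n") (auto simp: in_prime_factors_iff not_dvd_imp_multiplicity_0)
  then show ?thesis
    using p assms(1) by (subst sum_divisors_mu_inf) (auto intro!: prod_zero)
qed

section \<open>Dirichlet products of absolutely convergent series\<close>

lemma infsum_mult_infsum_eq_divisor_sum:
  fixes f g :: "nat \<Rightarrow> 'a::{banach, real_normed_field}"
  assumes f: "f abs_summable_on {0<..}" and g: "g abs_summable_on {0<..}"
  shows "infsum f {0<..} * infsum g {0<..} = (\<Sum>\<^sub>\<infinity>n\<in>{0<..}. \<Sum>d | d dvd n. f d * g (n div d))"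
proof -
  let ?S = "Sigma {0<..} (\<lambda>n. {d. d dvd n})"
  \<comment> \<open>Absolute summability of the double family justifies both exchanges between
    iterated and double sums below.\<close>
  have "(\<lambda>(d, e). f d * g e) abs_summable_on {0<..} \<times> {0<..}"
  proof (rule abs_summable_on_Sigma_iff[THEN iffD2], intro conjI ballI)
    show "(\<lambda>e. case (d, e) of (d, e) \<Rightarrow> f d * g e) abs_summable_on {0<..}" for d
      using g by (auto simp: norm_mult intro!: summable_on_cmult_right)
    show "(\<lambda>d. \<Sum>\<^sub>\<infinity>e\<in>{0<..}. norm (case (d, e) of (d, e) \<Rightarrow> f d * g e)) abs_summable_on {0<..}"
      using f by (auto simp: norm_mult infsum_cmult_right' abs_mult infsum_nonneg intro!: summable_on_cmult_left)
  qed
  then have sm: "(\<lambda>(d, e). f d * g e) summable_on {0<..} \<times> {0<..}"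
    by (rule abs_summable_summable)
  have "infsum f {0<..} * infsum g {0<..} = (\<Sum>\<^sub>\<infinity>d\<in>{0<..}. \<Sum>\<^sub>\<infinity>e\<in>{0<..}. f d * g e)"
    by (simp add: infsum_cmult_right' infsum_cmult_left')
  also have "\<dots> = (\<Sum>\<^sub>\<infinity>(d, e)\<in>{0<..} \<times> {0<..}. f d * g e)"
    using sm by (rule infsum_Sigma'_banach)
  \<comment> \<open>Pairs are regrouped by their product n = d * e. Putting \<open>n\<close> first
    makes the inner sum run over the finitely many divisors of \<open>n\<close>.\<close>
  also have "\<dots> = (\<Sum>\<^sub>\<infinity>(n, d)\<in>?S. f d * g (n div d))"
    by (rule infsum_reindex_bij_witness[where j = "\<lambda>(d, e). (d * e, d)" and i = "\<lambda>(n, d). (d, n div d)"])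
      (auto intro: Nat.gr0I)
  also have "\<dots> = (\<Sum>\<^sub>\<infinity>n\<in>{0<..}. \<Sum>\<^sub>\<infinity>d\<in>{d. d dvd n}. f d * g (n div d))"
  proof (rule infsum_Sigma'_banach[symmetric])
    show "(\<lambda>(n, d). f d * g (n div d)) summable_on ?S"
      using sm
      by (subst summable_on_reindex_bij_witness[where S = ?S and T = "{0<..} \<times> {0<..}"
            and i = "\<lambda>(d, e). (d * e, d)" and j = "\<lambda>(n, d). (d, n div d)"
            and h = "\<lambda>(d, e). f d * g e"])
        (auto intro: Nat.gr0I)
  qed
  also have "\<dots> = (\<Sum>\<^sub>\<infinity>n\<in>{0<..}. \<Sum>d | d dvd n. f d * g (n div d))"
    by (intro infsum_cong) simp
  finally show ?thesis .
qed

section \<open>From series with terms at \<open>Suc n\<close> to unordered sums over the positive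
  integers\<close>

lemma bij_betw_Suc_greaterThan: "bij_betw Suc UNIV {0<..}"
  by (auto simp: bij_betw_def image_Suc_lessThan greaterThan_0)

lemma abs_summable_on_greaterThan_0:
  fixes f :: "nat \<Rightarrow> 'a::banach"
  assumes "summable (\<lambda>n. norm (f (Suc n)))"
  shows "f abs_summable_on {0<..}"
proof -
  have "(\<lambda>n. norm (f (Suc n))) summable_on UNIV"
    using assms by (subst summable_on_UNIV_nonneg_real_iff) auto
  then show ?thesis
    using summable_on_reindex_bij_betw[OF bij_betw_Suc_greaterThan, of "\<lambda>n. norm (f n)"] by simp
qed

lemma suminf_Suc_eq_infsum:
  fixes f :: "nat \<Rightarrow> 'a::banach"
  assumes "summable (\<lambda>n. norm (f (Suc n)))"
  shows "(\<Sum>n. f (Suc n)) = infsum f {0<..}"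
proof -
  have "(\<lambda>n. f (Suc n)) summable_on UNIV"
    using assms by (rule norm_summable_imp_summable_on)
  then have "(\<Sum>n. f (Suc n)) = (\<Sum>\<^sub>\<infinity>n. f (Suc n))"
    by (metis has_sum_imp_sums has_sum_infsum sums_unique)
  also have "\<dots> = infsum f {0<..}"
    by (rule infsum_reindex_bij_betw[OF bij_betw_Suc_greaterThan])
  finally show ?thesis .
qed

section \<open>The functional equation linking s and 2s\<close>

lemma norm_mu_inf: "norm (of_int (mu_inf n) :: complex) = 1"
  using mu_inf_values[of n] by auto

lemma norm_mu_inf_term:
  "norm (of_int (mu_inf n) / of_nat n powr s :: complex) = real n powr - Re s"
  unfolding norm_divide norm_mu_inf by (simp add: norm_powr_real_powr powr_minus_divide)

lemma norm_zeta_term: "norm (inverse (of_nat n powr s) :: complex) = real n powr - Re s"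
  by (simp add: norm_inverse norm_powr_real_powr powr_minus)

lemma summable_Suc_powr:
  assumes "x > 1"
  shows "summable (\<lambda>n. real (Suc n) powr - x)"
  using assms by (subst summable_Suc_iff) (simp add: summable_real_powr_iff)

lemma zeta_times_mu_inf_series:
  assumes "Re s > 1"
  shows "zeta s * mu_inf_series s = mu_inf_series (2 * s)"
proof -
  define Z M M2 where "Z = (\<lambda>n. inverse (of_nat n powr s) :: complex)"
    and "M = (\<lambda>n. of_int (mu_inf n) / of_nat n powr s :: complex)"
    and "M2 = (\<lambda>n. of_int (mu_inf n) / of_nat n powr (2 * s) :: complex)"
  have Z: "summable (\<lambda>n. norm (Z (Suc n)))" and M: "summable (\<lambda>n. norm (M (Suc n)))"
    and M2: "summable (\<lambda>n. norm (M2 (Suc n)))"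
    unfolding Z_def M_def M2_def norm_zeta_term norm_mu_inf_term
    using assms by (auto intro!: summable_Suc_powr simp del: of_nat_Suc)
  have divisor_sum: "(\<Sum>d | d dvd n. M d * Z (n div d)) = of_int (\<Sum>d | d dvd n. mu_inf d) / of_nat n powr s" for n
  proof -
    have "M d * Z (n div d) = of_int (mu_inf d) / of_nat n powr s" if d: "d dvd n" for d
    proof -
      from d obtain e where "n = d * e" by auto
      \<comment> \<open>Complex powers are not multiplicative in the base in general; they are here
        because both bases are non-negative reals.\<close>
      moreover have "(of_nat d * of_nat e :: complex) powr s = of_nat d powr s * of_nat e powr s"
        by (rule powr_times_real) auto
      ultimately show ?thesis
        by (cases "d = 0") (auto simp: M_def Z_def field_simps)
    qed
    then show ?thesis
      by (simp add: sum_divide_distrib)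
  qed
  have "mu_inf_series s * zeta s = infsum M {0<..} * infsum Z {0<..}"
    using suminf_Suc_eq_infsum[OF Z] suminf_Suc_eq_infsum[OF M]
    by (simp add: mu_inf_series_def zeta_def Z_def M_def)
  also have "\<dots> = (\<Sum>\<^sub>\<infinity>n\<in>{0<..}. of_int (\<Sum>d | d dvd n. mu_inf d) / of_nat n powr s)"
    using Z M by (simp only: infsum_mult_infsum_eq_divisor_sum abs_summable_on_greaterThan_0 divisor_sum)
  \<comment> \<open>Non-squares contribute 0, and squaring is injective on positive integers, so the
    rest can be indexed by the square root.\<close>
  also have "\<dots> = (\<Sum>\<^sub>\<infinity>n\<in>power2 ` {0<..}. of_int (\<Sum>d | d dvd n. mu_inf d) / of_nat n powr s)"
  proof (rule infsum_cong_neutral)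
    fix n :: nat assume n: "n \<in> {0<..} - power2 ` {0<..}"
    then have "\<nexists>m. n = m\<^sup>2"
      by (auto simp: image_iff)
    with n show "of_int (\<Sum>d | d dvd n. mu_inf d) / of_nat n powr s = 0"
      by (simp add: sum_divisors_mu_inf_nonsquare)
  qed auto
  also have "\<dots> = (\<Sum>\<^sub>\<infinity>m\<in>{0<..}. of_int (\<Sum>d | d dvd m\<^sup>2. mu_inf d) / of_nat (m\<^sup>2) powr s)"
    by (subst infsum_reindex) (auto simp: inj_on_def o_def)
  also have "\<dots> = infsum M2 {0<..}"
  proof (rule infsum_cong)
    fix m :: nat assume m: "m \<in> {0<..}"
    have "(of_nat m * of_nat m :: complex) powr s = of_nat m powr s * of_nat m powr s"
      by (rule powr_times_real) auto
    also have "\<dots> = of_nat m powr (2 * s)"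
      by (simp only: mult_2 powr_add)
    finally show "of_int (\<Sum>d | d dvd m\<^sup>2. mu_inf d) / of_nat (m\<^sup>2) powr s = M2 m"
      using m sum_divisors_mu_inf_square[of m] by (simp add: M2_def power2_eq_square)
  qed
  also have "\<dots> = mu_inf_series (2 * s)"
    using suminf_Suc_eq_infsum[OF M2] by (simp add: mu_inf_series_def M2_def)
  finally show ?thesis
    by (simp add: mult.commute)
qed

section \<open>The limit along s, 2s, 4s, ... by dominated convergence of series\<close>

lemma tendsto_mu_inf_series:
  assumes "Re s > 1"
  shows "(\<lambda>N. mu_inf_series (2 ^ N * s)) \<longlonglongrightarrow> 1"
proof -
  define a where "a = (\<lambda>k N. of_int (mu_inf (Suc k)) / of_nat (Suc k) powr (2 ^ N * s) :: complex)"
  \<comment> \<open>This is the termwise limit of \<open>a\<close> in \<open>N\<close>: the term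
    with \<open>k = 0\<close> is constantly 1, since the base of its power is 1, and all others tend
    to 0.\<close>
  define b where "b = (\<lambda>k::nat. if k = 0 then 1 else 0 :: complex)"
  have Re: "Re (2 ^ N * s) = 2 ^ N * Re s" for N
    using Re_complex_of_real[of "2 ^ N"] Im_complex_of_real[of "2 ^ N"] by simp
  have norm_a: "norm (a k N) = real (Suc k) powr - (2 ^ N * Re s)" for k N
    unfolding a_def norm_mu_inf_term Re ..
  have "a k \<longlonglongrightarrow> b k" for k
  proof (cases k)
    case 0
    then show ?thesis
      using mu_inf_1 by (simp add: a_def b_def)
  next
    case (Suc l)
    define x where "x = real (Suc k) powr - Re s"
    have "x < 1"
      using assms Suc unfolding x_def by (simp add: powr_less_one)
    moreover have "x \<ge> 0"
      by (simp add: x_def)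
    \<comment> \<open>The norms form a subsequence of the powers of \<open>x\<close>, which tend to
      0 because 0 <= x < 1.\<close>
    moreover have "norm (a k N) = x ^ (2 ^ N)" for N
      unfolding norm_a x_def by (subst powr_power) (auto simp: mult.commute)
    ultimately have "(\<lambda>N. norm (a k N)) \<longlonglongrightarrow> 0"
      using filterlim_compose[OF LIMSEQ_power_zero, of x "\<lambda>N. 2 ^ N" sequentially]
        filterlim_subseq[of "\<lambda>N. 2 ^ N :: nat"]
      by (simp add: strict_mono_def)
    then show ?thesis
      using Suc by (simp add: b_def tendsto_norm_zero_iff)
  qed
  \<comment> \<open>The majorant is the case \<open>N = 0\<close>: larger \<open>N\<close> only
    makes the exponent more negative, and the base is at least 1.\<close>
  moreover have "norm (a k N) \<le> real (Suc k) powr - Re s" for k N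
    unfolding norm_a using assms by (intro powr_mono) (auto simp: mult_le_cancel_right1)
  then have "\<forall>\<^sub>F (k, N) in sequentially \<times>\<^sub>F sequentially. norm (a k N) \<le> real (Suc k) powr - Re s"
    by (intro always_eventually) auto
  ultimately have "(\<lambda>N. \<Sum>k. a k N) \<longlonglongrightarrow> suminf b"
    using summable_Suc_powr[OF assms]
    by (intro tannerys_theorem[where M = "\<lambda>k. real (Suc k) powr - Re s", THEN conjunct2, THEN conjunct2])
      auto
  moreover have "suminf b = 1"
    by (subst suminf_finite[of "{0}"]) (auto simp: b_def)
  ultimately show ?thesis
    by (simp add: mu_inf_series_def a_def)
qed

section \<open>Telescoping to the infinite product\<close>

theorem theorem1:
  fixes s :: complex
  assumes "Re s > 1"
  shows "summable (\<lambda>n. of_int (mu_inf (Suc n)) / (of_nat (Suc n) powr s :: complex))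
    \<and> convergent_prod (\<lambda>j::nat. inverse (zeta (2 ^ j * s)))
    \<and> mu_inf_series s = (\<Prod>j::nat. inverse (zeta (2 ^ j * s)))"
proof -
  have summable: "summable (\<lambda>n. of_int (mu_inf (Suc n)) / (of_nat (Suc n) powr s :: complex))"
    by (rule summable_norm_cancel, unfold norm_mu_inf_term) (rule summable_Suc_powr[OF assms])
  let ?m = "\<lambda>N. mu_inf_series (2 ^ N * s)"
  have lim: "?m \<longlonglongrightarrow> 1"
    using assms by (rule tendsto_mu_inf_series)
  have step: "zeta (2 ^ N * s) * ?m N = ?m (Suc N)" for N
  proof -
    have "Re (2 ^ N * s) = 2 ^ N * Re s"
      using Re_complex_of_real[of "2 ^ N"] Im_complex_of_real[of "2 ^ N"] by simp
    moreover have "1 * Re s \<le> 2 ^ N * Re s"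
      using assms by (intro mult_right_mono) auto
    ultimately have "Re (2 ^ N * s) > 1"
      using assms by linarith
    then show ?thesis
      using zeta_times_mu_inf_series[of "2 ^ N * s"] by (simp add: mult.assoc)
  qed
  \<comment> \<open>The starting index \<open>K\<close> stays free: \<open>K = 0\<close> gives the
    product formula, while general \<open>K\<close> is used to exclude zeros at every stage.\<close>
  have telescope: "(\<Prod>j<N. zeta (2 ^ (K + j) * s)) * ?m K = ?m (K + N)" for K N
  proof (induction N)
    case (Suc N)
    have "(\<Prod>j<Suc N. zeta (2 ^ (K + j) * s)) * ?m K
        = zeta (2 ^ (K + N) * s) * ((\<Prod>j<N. zeta (2 ^ (K + j) * s)) * ?m K)"
      by simp
    then show ?case
      by (simp only: Suc step add_Suc_right)
  qed simp
  \<comment> \<open>A zero at stage \<open>K\<close> would propagate to all later stages, against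
    the limit 1.\<close>
  have nonzero: "?m K \<noteq> 0" for K
  proof
    assume "?m K = 0"
    then have "?m (K + N) = 0" for N
      using telescope[of K N] by simp
    then have "(\<lambda>N. ?m (N + K)) \<longlonglongrightarrow> 0"
      by (simp add: add.commute)
    with LIMSEQ_ignore_initial_segment[OF lim, of K] show False
      using LIMSEQ_unique by fastforce
  qed
  have "(\<Prod>j\<le>N. inverse (zeta (2 ^ j * s))) = mu_inf_series s / ?m (Suc N)" for N
  proof -
    have "(\<Prod>j\<le>N. zeta (2 ^ j * s)) * mu_inf_series s = ?m (Suc N)"
      using telescope[where K = 0 and N = "Suc N"] by (simp add: lessThan_Suc_atMost)
    \<comment> \<open>A nonzero \<open>c\<close> forces \<open>P\<close> to be nonzero; applied to
      the finite product, this excludes zeros among its zeta factors.\<close>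
    moreover have "a / c = inverse P" if "P * a = c" "c \<noteq> 0" for P a c :: complex
      using that by (auto simp: field_simps)
    ultimately have "mu_inf_series s / ?m (Suc N) = inverse (\<Prod>j\<le>N. zeta (2 ^ j * s))"
      using nonzero[of "Suc N"] by metis
    then show ?thesis
      by (simp only: prod_inversef[unfolded comp_def])
  qed
  moreover have "(\<lambda>N. mu_inf_series s / ?m (Suc N)) \<longlonglongrightarrow> mu_inf_series s / 1"
    by (intro tendsto_divide tendsto_const LIMSEQ_Suc lim) simp
  \<comment> \<open>Besides convergence of the partial products, \<open>raw_has_prod\<close> demands
    a nonzero limit, which is \<open>nonzero\<close> at stage 0.\<close>
  ultimately have "raw_has_prod (\<lambda>j. inverse (zeta (2 ^ j * s))) 0 (mu_inf_series s)"
    using nonzero[of 0] by (simp add: raw_has_prod_def)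
  then have "(\<lambda>j. inverse (zeta (2 ^ j * s))) has_prod mu_inf_series s"
    by (simp add: has_prod_def)
  then show ?thesis
    using summable by (simp add: has_prod_iff)
qed

end
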